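(* Let $G=\mathbb{Z}_{p^k}$ for a prime $p$ and a positive integer $k$. Let $S$ be a proper subset of $G\setminus\{0\}$ that generates $G$ and let $S_0=S\cup\{0\}$. Let $0\in C\subseteq G$. Then $C$ is a perfect code in $\mathrm{Cay}(G,S)$ if and only if there are an integer $n\ge1$, integers $0=m_0<m_1<\cdots<m_n=k$ and integers $l_t$ with $1\leq l_t\leq m_{t+1}-m_t$ for $t\in[n]$, such that $$S_0=\left\{\sum_{t=0}^{n-1}\left(i_tp^{m_t}+\alpha_{i_0,\dots,i_t}p^{m_t+l_t}\right)\,\middle|\, i_t\in\left[p^{l_t}\right]\text{ for } t\in[n]\right\}$$ and $$C=\left\{\sum_{t=0}^{n-1}\left(i_tp^{m_t+l_t}+\beta_{i_0,\dots,i_t}p^{m_{t+1}}\right)\,\middle|\, i_t\in\left[p^{m_{t+1}-m_t-l_t}\right]\text{ for } t\in[n]\right\}$$ for some $\alpha_{i_0,\dots,i_t}$'s and $\beta_{i_0,\dots,i_t}$'s in $\mathbb{Z}_{p^k}$ with $\alpha_{0,\dots,0}=\beta_{0,\dots,0}=0$ (for each length of the index $(0,\dots,0)$).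
   Context: Groups are finite abelian, written additively; $\mathbb{Z}_n$ is the group of integers modulo $n$ and $[n]=\{0,1,\dots,n-1\}$. For $S\subseteq G\setminus\{0\}$, $\mathrm{Cay}(G,S)$ is the directed graph with vertex set $G$ and an arc from $x$ to $y$ if and only if $y-x\in S$ ($S$ is not assumed to be inverse-closed). A subset $C\subseteq G$ is a perfect code in $\mathrm{Cay}(G,S)$ if the sets $\{c\}\cup\{v:\text{there is an arc from } c \text{ to } v\}$, $c\in C$, form a partition of $G$. For each $t$, there is one element $\alpha_{i_0,\dots,i_t}$ (respectively $\beta_{i_0,\dots,i_t}$) for each tuple $(i_0,\dots,i_t)$ in the index ranges used in $S_0$ (respectively $C$). *)

theory Defs
  imports
    "HOL-Algebra.Elementary_Groups"
    "HOL-Algebra.Generated_Groups"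
    "HOL-Library.Disjoint_Sets"
    "HOL-Computational_Algebra.Primes"
    "Graph_Theory.Pair_Digraph"
begin

text \<open>
  Groups of \<open>HOL-Algebra\<close> are written multiplicatively, so the condition y - x \<in> S on an arc
  from x to y becomes \<open>y \<otimes> inv x \<in> S\<close>.
\<close>

definition Cay :: "('a, 'b) monoid_scheme \<Rightarrow> 'a set \<Rightarrow> 'a pair_pre_digraph" where
  "Cay G S = \<lparr> pverts = carrier G,
               parcs = {(x, y). x \<in> carrier G \<and> y \<in> carrier G \<and> y \<otimes>\<^bsub>G\<^esub> inv\<^bsub>G\<^esub> x \<in> S} \<rparr>"

definition closed_out_nbhd :: "('a, 'b) pre_digraph \<Rightarrow> 'a \<Rightarrow> 'a set" where
  "closed_out_nbhd D c = {c} \<union> {v. c \<rightarrow>\<^bsub>D\<^esub> v}"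

text \<open>
  The partition is understood as an indexed family: distinct elements of C must have disjoint
  (hence also distinct) closed out-neighbourhoods. Partitioning by the mere set of all closed
  out-neighbourhoods would be weaker, since distinct vertices may have the same one.
\<close>

definition perfect_code :: "('a, 'b) pre_digraph \<Rightarrow> 'a set \<Rightarrow> bool" where
  "perfect_code D C \<longleftrightarrow>
     C \<subseteq> verts D \<and>
     disjoint_family_on (closed_out_nbhd D) C \<and>
     (\<Union>c\<in>C. closed_out_nbhd D c) = verts D"

text \<open>
  \<open>index_tuples b r\<close> consists of the tuples (i_0, ..., i_{r-1}) with i_t in [b t], encoded as
  lists; the subscript (i_0, ..., i_t) of a coefficient is then the prefix \<open>take (Suc t) i\<close>.
\<close>

definition index_tuples :: "(nat \<Rightarrow> nat) \<Rightarrow> nat \<Rightarrow> nat list set" where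
  "index_tuples b r = {i. length i = r \<and> (\<forall>t<r. i ! t < b t)}"

definition coeff_family :: "int set \<Rightarrow> (nat \<Rightarrow> nat) \<Rightarrow> nat \<Rightarrow> (nat list \<Rightarrow> int) \<Rightarrow> bool" where
  "coeff_family A b n \<gamma> \<longleftrightarrow>
     (\<forall>t<n. (\<forall>i\<in>index_tuples b (Suc t). \<gamma> i \<in> A) \<and> \<gamma> (replicate (Suc t) 0) = 0)"

text \<open>
  The elements of \<^term>\<open>integer_mod_group N\<close> are the representatives 0, ..., N - 1, so a sum in
  this group is the integer sum reduced modulo N. The set below consists of the sums over t < n
  of i_t * p^(d t) + \<gamma>_(i_0, ..., i_t) * p^(e t).
\<close>

definition digit_sums ::
  "nat \<Rightarrow> nat \<Rightarrow> nat \<Rightarrow> (nat \<Rightarrow> nat) \<Rightarrow> (nat \<Rightarrow> nat) \<Rightarrow> (nat \<Rightarrow> nat) \<Rightarrow> (nat list \<Rightarrow> int) \<Rightarrow> int set" where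
  "digit_sums N p n b d e \<gamma> =
     {(\<Sum>t<n. int (i ! t) * int p ^ d t + \<gamma> (take (Suc t) i) * int p ^ e t) mod int N | i.
        i \<in> index_tuples b n}"

end

theory Submission
  imports
    Defs
    "HOL-Computational_Algebra.Polynomial"
    "HOL-Library.Infinite_Set"
    "HOL-Number_Theory.Cong"
begin

text \<open>
  Write \<open>A = S \<union> {0}\<close>. Since the closed out-neighbourhoods are the translates of \<open>A\<close>, the set \<open>C\<close>
  is a perfect code if and only if \<open>A\<close> and \<open>C\<close> tile the group: every element is \<open>a + c\<close> with
  \<open>a \<in> A\<close> and \<open>c \<in> C\<close> in exactly one way (\<open>perfect_code_Cay_iff\<close>).

  The heart of the matter is that in a tiling of the integers modulo \<open>p ^ k\<close> a difference of two
  distinct elements of \<open>A\<close> and a difference of two distinct elements of \<open>C\<close> never have the same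
  \<open>p\<close>-adic valuation (\<open>tiling_no_common_valuation\<close>). Such differences would be related by a factor
  \<open>u\<close> prime to \<open>p\<close>, contradicting that the dilate \<open>u A\<close> still tiles with \<open>C\<close>
  (\<open>dilate_tiling\<close>). For prime \<open>u\<close> the latter follows from \<open>A(X)^u = A(X^u)\<close> modulo \<open>u\<close>
  in the group ring; in general, one dilates by the prime factors of \<open>u\<close> one after another.

  Now regard the elements of the group as strings of \<open>k\<close> digits in base \<open>p\<close>. The valuation of a
  difference is the lowest position at which the digits differ. If \<open>D\<close> is the set of valuations
  that occur for \<open>A\<close>, then an element of \<open>A\<close> is determined by its digits at positions in \<open>D\<close>, and
  an element of \<open>C\<close> by its digits at the other positions. So \<open>A\<close> has at most \<open>p ^ card D\<close> elements
  and \<open>C\<close> at most \<open>p ^ (k - card D)\<close>; because the product of their sizes is \<open>p ^ k\<close>, equality holds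
  and all digits at these positions can be chosen freely, each remaining digit being a
  function of the free digits below it. This is what the digit sums express: the index
  \<open>i_t\<close> is a block of free digits, the coefficient attached to \<open>(i_0, ..., i_t)\<close> describes the digits
  up to the next free block (\<open>eq_digit_sums\<close>, \<open>tiling_imp_digit_sums\<close>). As \<open>S\<close> generates the group,
  it has an element prime to \<open>p\<close>, and therefore the first free block of \<open>A\<close> starts at position 0.

  Conversely, from the sum of two such digit sums all indices can be recovered block by block, and a
  count shows that the sums exhaust the group (\<open>digit_sums_tile\<close>).
\<close>

section \<open>Dilations of tilings\<close>

text \<open>
  The freshman's dream modulo a prime. It is stated as a divisibility in a ring of arbitrary
  characteristic because it is applied both to integer polynomials and, with all summands equal
  to 1, to the integers, where it is Fermat's little theorem.
\<close>

lemma prime_dvd_power_sum_diff: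
  fixes f :: "'a \<Rightarrow> 'b::comm_ring_1"
  assumes "prime q" and "finite I"
  shows "of_nat q dvd (\<Sum>x\<in>I. f x) ^ q - (\<Sum>x\<in>I. f x ^ q)"
  using assms(2)
proof (induction I rule: finite_induct)
  case empty
  then show ?case using prime_gt_0_nat[OF assms(1)] by (simp add: zero_power)
next
  case (insert x I)
  define a b where "a = f x" and "b = (\<Sum>x\<in>I. f x)"
  have q: "q > 0" using assms(1) by (simp add: prime_gt_0_nat)
  define h where "h k = of_nat (q choose k) * a ^ k * b ^ (q - k)" for k
  have "(a + b) ^ q = (\<Sum>k\<le>q. h k)"
    by (simp add: binomial_ring h_def)
  also have "{..q} = insert 0 (insert q {0<..<q})"
    using q by auto
  also have "(\<Sum>k\<in>\<dots>. h k) = b ^ q + (a ^ q + (\<Sum>k\<in>{0<..<q}. h k))"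
    using q by (simp add: h_def)
  finally have "(a + b) ^ q - a ^ q - b ^ q = (\<Sum>k\<in>{0<..<q}. h k)"
    by simp
  moreover have "(of_nat q :: 'b) dvd (\<Sum>k\<in>{0<..<q}. h k)"
  proof (rule dvd_sum)
    fix k assume "k \<in> {0<..<q}"
    then have "q dvd q choose k"
      using assms(1) by (intro dvd_choose_prime) auto
    then have "(of_nat q :: 'b) dvd of_nat (q choose k)"
      by (auto elim!: dvdE)
    then show "of_nat q dvd h k" by (simp add: h_def)
  qed
  ultimately have "of_nat q dvd ((a + b) ^ q - a ^ q - b ^ q) + (b ^ q - (\<Sum>x\<in>I. f x ^ q))"
    using insert.IH by (simp add: b_def)
  then show ?case
    using insert.hyps by (simp add: a_def b_def algebra_simps)
qed

text \<open>
  The coefficient of \<open>X^r\<close> in the residue of \<open>P\<close> modulo \<open>X^N - 1\<close>: this functional stands in for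
  the group ring of the integers modulo \<open>N\<close>.
\<close>

definition folded_coeff :: "nat \<Rightarrow> nat \<Rightarrow> int poly \<Rightarrow> int" where
  "folded_coeff N r P = (\<Sum>i\<le>degree P. if i mod N = r then coeff P i else 0)"

lemma folded_coeff_altdef:
  assumes "degree P \<le> n"
  shows "folded_coeff N r P = (\<Sum>i\<le>n. if i mod N = r then coeff P i else 0)"
  unfolding folded_coeff_def
  by (rule sum.mono_neutral_left) (use assms in \<open>auto simp: coeff_eq_0\<close>)

lemma folded_coeff_add: "folded_coeff N r (P + Q) = folded_coeff N r P + folded_coeff N r Q"
proof -
  define n where "n = max (degree P) (degree Q)"
  have "degree (P + Q) \<le> n" by (simp add: n_def degree_add_le)
  then show ?thesis
    by (subst (1 2 3) folded_coeff_altdef[of _ n])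
      (auto simp: n_def simp flip: sum.distrib intro!: sum.cong)
qed

lemma folded_coeff_0 [simp]: "folded_coeff N r 0 = 0"
  by (simp add: folded_coeff_def cong: if_cong)

lemma folded_coeff_sum: "folded_coeff N r (\<Sum>x\<in>I. f x) = (\<Sum>x\<in>I. folded_coeff N r (f x))"
  by (induction I rule: infinite_finite_induct) (simp_all add: folded_coeff_add)

lemma folded_coeff_monom: "folded_coeff N r (monom c m) = (if m mod N = r then c else 0)"
proof -
  have "folded_coeff N r (monom c m)
      = (\<Sum>i\<le>m. if i = m then if m mod N = r then c else 0 else 0)"
    by (simp only: folded_coeff_altdef[OF degree_monom_le], rule sum.cong) auto
  then show ?thesis by simp
qed

lemma folded_coeff_of_nat_mult: "folded_coeff N r (of_nat q * P) = int q * folded_coeff N r P"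
  by (induction q) (simp_all add: folded_coeff_add algebra_simps)

text \<open>
  In the group ring, multiplying the sum of all group elements by \<open>X^m\<close> permutes its terms, so this
  sum is an eigenvector of multiplication by any \<open>P\<close>, with eigenvalue \<open>P(1)\<close>.
\<close>

lemma folded_coeff_mult_uniform:
  assumes uniform: "\<And>r. r < N \<Longrightarrow> folded_coeff N r Q = 1" and "r < N"
  shows "folded_coeff N r (P * Q) = poly P 1"
proof -
  have monom: "folded_coeff N r (monom c m * Q) = c" for c m
  proof -
    define r' where "r' = (r + (N * m - m)) mod N"
    have shift: "(m + i) mod N = r \<longleftrightarrow> i mod N = r'" for i
    proof -
      have m: "m \<le> N * m" using \<open>r < N\<close> by simp
      have "(m + i) mod N = r \<longleftrightarrow> [m + i = r] (mod N)"
        using \<open>r < N\<close> by (simp add: cong_def)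
      also have "\<dots> \<longleftrightarrow> [i + m + (N * m - m) = r + (N * m - m)] (mod N)"
        by (simp add: cong_add_rcancel_nat add.commute)
      also have "i + m + (N * m - m) = i + N * m" using m by simp
      also have "[i + N * m = r + (N * m - m)] (mod N) \<longleftrightarrow> i mod N = r'"
        by (simp add: cong_def r'_def)
      finally show ?thesis .
    qed
    have "monom c m * Q = (\<Sum>i\<le>degree Q. monom (c * coeff Q i) (m + i))"
      by (subst poly_as_sum_of_monoms[of Q, symmetric])
        (simp only: sum_distrib_left mult_monom)
    then have "folded_coeff N r (monom c m * Q)
        = (\<Sum>i\<le>degree Q. if (m + i) mod N = r then c * coeff Q i else 0)"
      by (simp add: folded_coeff_sum folded_coeff_monom)
    also have "\<dots> = c * folded_coeff N r' Q"
      by (simp add: shift folded_coeff_def sum_distrib_left if_distrib cong: if_cong)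
    also have "folded_coeff N r' Q = 1"
      using \<open>r < N\<close> by (intro uniform) (simp add: r'_def)
    finally show ?thesis by simp
  qed
  have "P * Q = (\<Sum>i\<le>degree P. monom (coeff P i) i * Q)"
    by (subst poly_as_sum_of_monoms[of P, symmetric]) (simp only: sum_distrib_right)
  then show ?thesis
    by (simp add: folded_coeff_sum monom poly_altdef)
qed

text \<open>
  Write \<open>A(X)\<close> and \<open>B(X)\<close> for the sums of the monomials \<open>X^(f x)\<close> and \<open>X^(g y)\<close>. The hypothesis
  says that \<open>A B\<close> is the sum of all group elements modulo \<open>X^N - 1\<close>; hence every folded coefficient
  of \<open>A^q B = A^(q - 1) (A B)\<close> is \<open>card I ^ (q - 1)\<close>, which is 1 modulo \<open>q\<close>. Since \<open>A(X)^q\<close> is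
  congruent to \<open>A(X^q)\<close> modulo \<open>q\<close>, no folded coefficient of \<open>A(X^q) B(X)\<close> vanishes: each residue
  is attained, and then it is attained only once, because there are only \<open>N\<close> pairs.
\<close>

lemma dilate_tiling_prime:
  fixes f :: "'a \<Rightarrow> nat" and g :: "'b \<Rightarrow> nat"
  assumes bij: "bij_betw (\<lambda>(x, y). (f x + g y) mod N) (I \<times> J) {..<N}"
    and "finite I" "finite J" and "prime q" and "\<not> q dvd card I"
  shows "bij_betw (\<lambda>(x, y). (q * f x + g y) mod N) (I \<times> J) {..<N}"
proof -
  define A B A' :: "int poly"
    where "A = (\<Sum>x\<in>I. monom 1 (f x))" and "B = (\<Sum>y\<in>J. monom 1 (g y))"
      and "A' = (\<Sum>x\<in>I. monom 1 (q * f x))"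
  have count: "folded_coeff N r ((\<Sum>x\<in>I. monom 1 (h x)) * B) =
      int (card {z \<in> I \<times> J. (h (fst z) + g (snd z)) mod N = r})" for h r
  proof -
    have "(\<Sum>x\<in>I. monom 1 (h x)) * B = (\<Sum>z\<in>I \<times> J. monom 1 (h (fst z) + g (snd z)))"
      unfolding B_def sum_product sum.cartesian_product mult_monom by (simp add: case_prod_unfold)
    then have "folded_coeff N r ((\<Sum>x\<in>I. monom 1 (h x)) * B) =
        (\<Sum>z\<in>I \<times> J. if (h (fst z) + g (snd z)) mod N = r then 1 else 0)"
      by (simp add: folded_coeff_sum folded_coeff_monom)
    also have "\<dots> = int (card {z \<in> I \<times> J. (h (fst z) + g (snd z)) mod N = r})"
      using \<open>finite I\<close> \<open>finite J\<close> by (subst sum.If_cases) (auto simp: Int_def)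
    finally show ?thesis .
  qed
  have uniform: "folded_coeff N r (A * B) = 1" if "r < N" for r
  proof -
    have "r \<in> (\<lambda>(x, y). (f x + g y) mod N) ` (I \<times> J)"
      using bij that by (simp add: bij_betw_def)
    then obtain z where z: "z \<in> I \<times> J" "(f (fst z) + g (snd z)) mod N = r"
      by (auto simp: case_prod_unfold)
    have "z' = z" if "z' \<in> I \<times> J" "(f (fst z') + g (snd z')) mod N = r" for z'
      using inj_onD[OF bij_betw_imp_inj_on[OF bij], of z' z] z that by (simp add: case_prod_unfold)
    with z have "{z \<in> I \<times> J. (f (fst z) + g (snd z)) mod N = r} = {z}"
      by blast
    then show ?thesis by (simp add: A_def count)
  qed
  have q: "q > 0" using \<open>prime q\<close> by (simp add: prime_gt_0_nat)
  have card_power: "int q dvd int (card I) ^ (q - 1) - 1"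
  proof -
    have "int q dvd int (card I) ^ q - int (card I)"
      using prime_dvd_power_sum_diff[OF \<open>prime q\<close> \<open>finite I\<close>, of "\<lambda>_. 1::int"] by simp
    also have "int (card I) ^ q - int (card I) = int (card I) * (int (card I) ^ (q - 1) - 1)"
      using q by (cases q) (simp_all add: algebra_simps)
    finally show ?thesis
      using \<open>prime q\<close> \<open>\<not> q dvd card I\<close> by (simp add: prime_dvd_mult_iff)
  qed
  have hit: "\<exists>z\<in>I \<times> J. (q * f (fst z) + g (snd z)) mod N = r" if "r < N" for r
  proof -
    have "A' = (\<Sum>x\<in>I. monom 1 (f x) ^ q)"
      by (simp add: A'_def monom_power mult.commute)
    then have "of_nat q dvd A ^ q - A'"
      using prime_dvd_power_sum_diff[OF \<open>prime q\<close> \<open>finite I\<close>, of "\<lambda>x. monom (1::int) (f x)"]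
      by (simp add: A_def)
    then obtain R where R: "A ^ q = A' + of_nat q * R"
      by (metis dvdE diff_add_cancel add.commute)
    have "A ^ (q - 1) * (A * B) = A ^ q * B"
      using q by (cases q) (simp_all add: mult_ac)
    also have "\<dots> = A' * B + of_nat q * (R * B)"
      by (simp add: R algebra_simps)
    finally have "folded_coeff N r (A' * B) + int q * folded_coeff N r (R * B)
        = poly (A ^ (q - 1)) 1"
      using folded_coeff_mult_uniform[OF uniform that, of "A ^ (q - 1)"]
      by (simp add: folded_coeff_add folded_coeff_of_nat_mult)
    also have "\<dots> = int (card I) ^ (q - 1)"
      by (simp add: A_def poly_sum poly_monom)
    finally have "\<not> int q dvd folded_coeff N r (A' * B)"
      using card_power \<open>prime q\<close>
      by (metis dvd_add_right_iff dvd_diff_right_iff dvd_triv_left not_prime_unit prime_nat_int_transfer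
          dvd_add_left_iff dvd_diff_commute)
    then have "folded_coeff N r (A' * B) \<noteq> 0" by auto
    then have "{z \<in> I \<times> J. (q * f (fst z) + g (snd z)) mod N = r} \<noteq> {}"
      unfolding A'_def by (subst (asm) count) (metis card.empty of_nat_0)
    then show ?thesis by auto
  qed
  let ?h = "\<lambda>(x, y). (q * f x + g y) mod N"
  have "finite (I \<times> J)" using \<open>finite I\<close> \<open>finite J\<close> by simp
  have card: "card (I \<times> J) = N"
    using bij_betw_same_card[OF bij] by simp
  have image: "?h ` (I \<times> J) = {..<N}"
  proof
    show "?h ` (I \<times> J) \<subseteq> {..<N}"
    proof (cases "N = 0")
      case True
      then have "I \<times> J = {}" using card \<open>finite (I \<times> J)\<close> by simp
      then show ?thesis by (metis empty_subsetI image_empty)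
    qed auto
    show "{..<N} \<subseteq> ?h ` (I \<times> J)"
    proof
      fix r assume "r \<in> {..<N}"
      then have "r < N" by simp
      from hit[OF this] obtain z where "z \<in> I \<times> J" "(q * f (fst z) + g (snd z)) mod N = r"
        by (elim bexE)
      then show "r \<in> ?h ` (I \<times> J)"
        by (intro image_eqI[of _ _ z]) (simp_all add: case_prod_unfold)
    qed
  qed
  moreover have "inj_on ?h (I \<times> J)"
    using \<open>finite (I \<times> J)\<close> card image by (intro eq_card_imp_inj_on) simp_all
  ultimately show ?thesis by (simp add: bij_betw_def)
qed

lemma dilate_tiling:
  fixes f :: "'a \<Rightarrow> nat" and g :: "'b \<Rightarrow> nat"
  assumes "bij_betw (\<lambda>(x, y). (f x + g y) mod N) (I \<times> J) {..<N}"
    and "finite I" "finite J" and "coprime u (card I)" and "u > 0"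
  shows "bij_betw (\<lambda>(x, y). (u * f x + g y) mod N) (I \<times> J) {..<N}"
  using assms(4,5)
proof (induction u rule: less_induct)
  case (less u)
  show ?case
  proof (cases "u = 1")
    case True
    then show ?thesis using assms(1) by simp
  next
    case False
    then obtain q v where q: "prime q" and u: "u = q * v"
      using prime_factor_nat[of u] by (auto elim: dvdE)
    have "v < u" using q u less.prems prime_gt_1_nat[OF q] by simp
    moreover have "coprime v (card I)" and "\<not> q dvd card I"
      using less.prems q by (auto simp: u prime_imp_coprime_nat coprime_absorb_left
          dest: not_prime_unit)
    ultimately have "bij_betw (\<lambda>(x, y). (v * f x + g y) mod N) (I \<times> J) {..<N}"
      using less.IH less.prems u by simp
    from dilate_tiling_prime[OF this assms(2,3) q \<open>\<not> q dvd card I\<close>]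
    show ?thesis by (simp add: u mult.assoc)
  qed
qed

section \<open>Valuations of differences in a tiling\<close>

text \<open>
  If \<open>a - a'\<close> and \<open>b - b'\<close> have the same \<open>p\<close>-adic valuation, then some \<open>u\<close> prime to \<open>p\<close> satisfies
  \<open>u (a - a') = b' - b\<close> modulo \<open>p ^ k\<close>, so \<open>u a + b = u a' + b'\<close>. But \<open>card A\<close> is a power of \<open>p\<close>,
  so dilating \<open>A\<close> by \<open>u\<close> preserves the tiling.
\<close>

lemma tiling_no_common_valuation:
  fixes p k j :: nat and A B :: "int set"
  assumes "prime p"
    and tiling: "bij_betw (\<lambda>(a, b). (a + b) mod int (p ^ k)) (A \<times> B) {0..<int (p ^ k)}"
    and A: "A \<subseteq> {0..<int (p ^ k)}" and B: "B \<subseteq> {0..<int (p ^ k)}"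
    and "a \<in> A" "a' \<in> A" "b \<in> B" "b' \<in> B" and "j < k"
    and a: "int p ^ j dvd a - a'" "\<not> int p ^ Suc j dvd a - a'"
    and b: "int p ^ j dvd b - b'" "\<not> int p ^ Suc j dvd b - b'"
  shows False
proof -
  define N where "N = p ^ k"
  have p: "prime (int p)" using \<open>prime p\<close> by simp
  have "finite A" and "finite B"
    using A B by (auto intro: finite_subset)
  have nat_tiling: "bij_betw (\<lambda>(x, y). (nat x + nat y) mod N) (A \<times> B) {..<N}"
  proof -
    have "bij_betw nat {0..<int N} {..<N}"
      by (rule bij_betw_byWitness[where f' = int]) auto
    from bij_betw_trans[OF tiling[folded N_def] this]
    have "bij_betw (nat \<circ> (\<lambda>(x, y). (x + y) mod int N)) (A \<times> B) {..<N}" .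
    moreover have "(nat \<circ> (\<lambda>(x, y). (x + y) mod int N)) z = (\<lambda>(x, y). (nat x + nat y) mod N) z"
      if "z \<in> A \<times> B" for z
    proof -
      have "fst z \<ge> 0" "snd z \<ge> 0" using that A B by auto
      then show ?thesis by (simp add: case_prod_unfold nat_mod_distrib nat_add_distrib)
    qed
    ultimately show ?thesis using bij_betw_cong by (metis (no_types, lifting))
  qed
  obtain x where x: "a - a' = int p ^ j * x" using a(1) by (elim dvdE)
  obtain y where y: "b' - b = int p ^ j * y" using b(1) by (metis dvdE dvd_diff_commute)
  have "\<not> int p dvd x" using a(2) x by auto
  have "\<not> int p dvd y"
  proof
    assume "int p dvd y"
    then have "int p ^ Suc j dvd b' - b" by (simp add: y)
    then show False using b(2) by (simp only: dvd_diff_commute)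
  qed
  have "coprime x (int p ^ k)"
    using p \<open>\<not> int p dvd x\<close> by (metis coprime_commute coprime_power_right_iff prime_imp_coprime)
  then obtain x' where x': "[x * x' = 1] (mod (int p ^ k))"
    using cong_solve_coprime_int by blast
  have "int p dvd int p ^ k" using \<open>j < k\<close> by simp
  \<comment> \<open>\<open>u\<close> represents \<open>y / x\<close>, hence satisfies \<open>u (a - a') = b' - b\<close> modulo \<open>p ^ k\<close>\<close>
  define u where "u = nat ((y * x') mod int p ^ k)"
  have pk: "int p ^ k > 0" using \<open>prime p\<close> by (simp add: prime_gt_0_nat)
  have int_u: "int u = (y * x') mod int p ^ k"
    using pk by (simp add: u_def)
  have "\<not> int p dvd x'"
  proof
    assume "int p dvd x'"
    have "[x * x' = 1] (mod int p)"
      using x' \<open>int p dvd int p ^ k\<close> cong_dvd_modulus by blast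
    with \<open>int p dvd x'\<close> have "int p dvd 1" using cong_dvd_iff dvd_mult by blast
    then show False using p not_prime_unit by blast
  qed
  then have "\<not> int p dvd int u"
    unfolding int_u using p \<open>\<not> int p dvd y\<close> \<open>int p dvd int p ^ k\<close>
    by (simp add: dvd_mod_iff prime_dvd_mult_iff)
  then have "\<not> p dvd u" by simp
  moreover have "card A * card B = p ^ k"
    using bij_betw_same_card[OF tiling] by (simp add: card_cartesian_product del: of_nat_power)
  then have "card A dvd p ^ k" by (metis dvd_triv_left)
  then obtain i where "card A = p ^ i"
    using divides_primepow_nat[OF \<open>prime p\<close>] by auto
  ultimately have "coprime u (card A)"
    using \<open>prime p\<close> by (metis coprime_commute coprime_power_right_iff prime_imp_coprime)
  moreover have "u > 0" using \<open>\<not> p dvd u\<close> by (cases u) auto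
  ultimately have inj: "inj_on (\<lambda>(x, y). (u * nat x + nat y) mod N) (A \<times> B)"
    using dilate_tiling[OF nat_tiling \<open>finite A\<close> \<open>finite B\<close>] by (simp add: bij_betw_def)
  have "[int u * x = y * x' * x] (mod int p ^ k)"
    by (simp add: int_u cong_def mod_simps)
  also have "[y * x' * x = y] (mod int p ^ k)"
    using cong_scalar_left[OF x', of y] by (simp add: mult_ac)
  finally have "[int p ^ j * (int u * x) = int p ^ j * y] (mod int p ^ k)"
    by (rule cong_scalar_left)
  then have "[int u * (a - a') = b' - b] (mod int p ^ k)"
    by (simp add: x y mult_ac)
  then have "[int u * (a - a') + (int u * a' + b) = b' - b + (int u * a' + b)] (mod int p ^ k)"
    by (rule cong_add) simp
  then have "[int u * a + b = int u * a' + b'] (mod int p ^ k)"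
    by (simp add: algebra_simps)
  moreover have "a = int (nat a)" "a' = int (nat a')" "b = int (nat b)" "b' = int (nat b')"
    using A B \<open>a \<in> A\<close> \<open>a' \<in> A\<close> \<open>b \<in> B\<close> \<open>b' \<in> B\<close> by auto
  ultimately have "[int (u * nat a + nat b) = int (u * nat a' + nat b')] (mod int N)"
    by (simp add: N_def)
  then have "[u * nat a + nat b = u * nat a' + nat b'] (mod N)"
    by (simp only: cong_int_iff)
  then have "(u * nat a + nat b) mod N = (u * nat a' + nat b') mod N"
    by (simp add: cong_def)
  then have "a = a'"
    using inj_onD[OF inj, of "(a, b)" "(a', b')"] \<open>a \<in> A\<close> \<open>a' \<in> A\<close> \<open>b \<in> B\<close> \<open>b' \<in> B\<close> by simp
  then show False using a(2) by simp
qed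

section \<open>Digit sums with complementary free blocks tile\<close>

lemma index_tuples_Suc:
  "index_tuples b (Suc n) = (\<lambda>(i, x). i @ [x]) ` (index_tuples b n \<times> {..<b n})"
proof
  show "index_tuples b (Suc n) \<subseteq> (\<lambda>(i, x). i @ [x]) ` (index_tuples b n \<times> {..<b n})"
  proof
    fix i assume i: "i \<in> index_tuples b (Suc n)"
    then have "i = take n i @ [i ! n]"
      by (auto simp: index_tuples_def simp flip: take_Suc_conv_app_nth)
    moreover have "take n i \<in> index_tuples b n" "i ! n < b n"
      using i by (auto simp: index_tuples_def)
    ultimately show "i \<in> (\<lambda>(i, x). i @ [x]) ` (index_tuples b n \<times> {..<b n})"
      by (intro image_eqI[of _ _ "(take n i, i ! n)"]) auto
  qed
qed (auto simp: index_tuples_def nth_append less_Suc_eq)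

lemma finite_card_index_tuples: "finite (index_tuples b n) \<and> card (index_tuples b n) = (\<Prod>t<n. b t)"
proof (induction n)
  case 0
  have "index_tuples b 0 = {[]}" by (auto simp: index_tuples_def)
  then show ?case by simp
next
  case (Suc n)
  have "inj_on (\<lambda>(i, x). i @ [x]) (index_tuples b n \<times> {..<b n})"
    by (auto simp: inj_on_def)
  then show ?case
    using Suc by (simp add: index_tuples_Suc card_image card_cartesian_product)
qed

definition digit_value ::
  "nat \<Rightarrow> nat \<Rightarrow> (nat \<Rightarrow> nat) \<Rightarrow> (nat \<Rightarrow> nat) \<Rightarrow> (nat list \<Rightarrow> int) \<Rightarrow> nat list \<Rightarrow> int" where
  "digit_value p n d e \<gamma> i =
     (\<Sum>t<n. int (i ! t) * int p ^ d t + \<gamma> (take (Suc t) i) * int p ^ e t)"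

lemma digit_sums_eq:
  "digit_sums N p n b d e \<gamma> = (\<lambda>i. digit_value p n d e \<gamma> i mod int N) ` index_tuples b n"
  by (auto simp: digit_sums_def digit_value_def)

lemma nth_take_eqI: "take t i = take t i' \<Longrightarrow> r < t \<Longrightarrow> i ! r = i' ! r"
  by (metis nth_take)

lemma take_Suc_take_eqI: "take t i = take t i' \<Longrightarrow> r < t \<Longrightarrow> take (Suc r) i = take (Suc r) i'"
  by (metis Suc_leI min.absorb1 take_take)

text \<open>
  Together with the next lemma, this reads the digits off successively: a common prefix of two index
  tuples makes their values agree below the next free block, and below the end of that block the values
  differ just by the difference of the indices with number \<open>t\<close>, placed at position \<open>d t\<close>.
\<close>

lemma digit_value_cong:
  assumes "take t i = take t i'" and "\<And>r. t \<le> r \<Longrightarrow> r < n \<Longrightarrow> M \<le> d r \<and> M \<le> e r"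
  shows "[digit_value p n d e \<gamma> i = digit_value p n d e \<gamma> i'] (mod int p ^ M)"
  unfolding digit_value_def
proof (rule cong_sum)
  fix r assume "r \<in> {..<n}"
  define T where "T i = int (i ! r) * int p ^ d r + \<gamma> (take (Suc r) i) * int p ^ e r" for i
  have "[T i = T i'] (mod int p ^ M)"
  proof (cases "r < t")
    case True
    then show ?thesis
      by (simp add: T_def nth_take_eqI[OF assms(1)] take_Suc_take_eqI[OF assms(1)])
  next
    case False
    then have "int p ^ M dvd T i" for i
      using assms(2)[of r] \<open>r \<in> {..<n}\<close>
      by (auto simp: T_def intro!: dvd_add dvd_mult le_imp_power_dvd)
    then show ?thesis by (simp add: cong_iff_dvd_diff)
  qed
  then show "[int (i ! r) * int p ^ d r + \<gamma> (take (Suc r) i) * int p ^ e r =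
      int (i' ! r) * int p ^ d r + \<gamma> (take (Suc r) i') * int p ^ e r] (mod int p ^ M)"
    by (simp add: T_def)
qed

lemma digit_value_diff_cong:
  assumes "take t i = take t i'" and "t < n"
    and "\<And>r. t < r \<Longrightarrow> r < n \<Longrightarrow> e t \<le> d r \<and> e t \<le> e r"
  shows "[digit_value p n d e \<gamma> i - digit_value p n d e \<gamma> i' =
      (int (i ! t) - int (i' ! t)) * int p ^ d t] (mod int p ^ e t)"
proof -
  define T where "T r i = int (i ! r) * int p ^ d r + \<gamma> (take (Suc r) i) * int p ^ e r" for r i
  define D where "D = (int (i ! t) - int (i' ! t)) * int p ^ d t"
  have "[T r i - T r i' = (if r = t then D else 0)] (mod int p ^ e t)" if "r < n" for r
  proof (cases r t rule: linorder_cases)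
    case less
    then show ?thesis
      by (simp add: T_def nth_take_eqI[OF assms(1)] take_Suc_take_eqI[OF assms(1)])
  next
    case equal
    then show ?thesis
      by (simp add: T_def D_def cong_iff_dvd_diff algebra_simps)
  next
    case greater
    then have "int p ^ e t dvd T r i" for i
      using assms(3)[of r] that
      by (auto simp: T_def intro!: dvd_add dvd_mult le_imp_power_dvd)
    then show ?thesis using greater by (simp add: cong_0_iff)
  qed
  then have "[(\<Sum>r<n. T r i - T r i') = (\<Sum>r<n. if r = t then D else 0)] (mod int p ^ e t)"
    by (intro cong_sum) simp
  then show ?thesis
    using \<open>t < n\<close> by (simp add: digit_value_def T_def D_def sum_subtractf)
qed

lemma mult_power_cong_0_imp_eq:
  fixes x y p d e :: nat
  assumes "[(int x - int y) * int p ^ d = 0] (mod int p ^ e)"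
    and "p > 0" "d \<le> e" and "x < p ^ (e - d)" "y < p ^ (e - d)"
  shows "x = y"
proof -
  have "int p ^ (e - d) * int p ^ d dvd (int x - int y) * int p ^ d"
    using assms(1,3) by (simp add: cong_0_iff flip: power_add)
  then have "int p ^ (e - d) dvd int x - int y"
    using \<open>p > 0\<close> by simp
  then have "[int x = int y] (mod int (p ^ (e - d)))"
    by (simp add: cong_iff_dvd_diff)
  then show ?thesis
    using assms(4,5) by (simp only: cong_int_iff cong_less_modulus_unique_nat)
qed

lemma steps_mono:
  fixes m :: "nat \<Rightarrow> nat"
  assumes "\<And>t. t < n \<Longrightarrow> m t \<le> m (Suc t)" and "s \<le> t" "t \<le> n"
  shows "m s \<le> m t"
  using assms(2,3)
proof (induction t rule: dec_induct)
  case (step t)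
  then show ?case using assms(1)[of t] by simp
qed simp

text \<open>
  The blocks of lengths \<open>l t\<close> and \<open>m (Suc t) - m t - l t\<close> fill the interval from 0 to \<open>m n\<close>, so the
  two families of index tuples together have the size of the group.
\<close>

lemma prod_power_steps:
  fixes p n :: nat and m l :: "nat \<Rightarrow> nat"
  assumes "m 0 = 0" and "\<And>t. t < n \<Longrightarrow> m t \<le> m (Suc t)"
    and "\<And>t. t < n \<Longrightarrow> l t \<le> m (Suc t) - m t"
  shows "(\<Prod>t<n. p ^ l t) * (\<Prod>t<n. p ^ (m (Suc t) - m t - l t)) = p ^ m n"
  using assms(2,3)
proof (induction n)
  case 0
  then show ?case using assms(1) by simp
next
  case (Suc n)
  have "l n + (m (Suc n) - m n - l n) + m n = m (Suc n)"
    using Suc.prems[of n] by simp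
  then have "p ^ l n * p ^ (m (Suc n) - m n - l n) * p ^ m n = p ^ m (Suc n)"
    by (simp only: flip: power_add)
  then show ?case using Suc by (simp add: mult_ac)
qed

text \<open>
  The sum of an element of \<open>A\<close> and an element of \<open>C\<close> determines both index tuples. Once the first
  \<open>t\<close> indices of both are known, \<open>C\<close> contributes a known amount modulo \<open>p ^ (m t + l t)\<close>, so the
  next index of \<open>A\<close> can be read off; then \<open>A\<close> contributes a known amount modulo \<open>p ^ m (Suc t)\<close>, and
  the next index of \<open>C\<close> can be read off. Injectivity suffices, since there are \<open>p ^ k\<close> pairs of
  index tuples.
\<close>

lemma digit_sums_tile:
  fixes p k n :: nat and m l :: "nat \<Rightarrow> nat"
  assumes "p > 0" and m: "m 0 = 0" "m n = k" "\<And>t. t < n \<Longrightarrow> m t \<le> m (Suc t)"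
    and l: "\<And>t. t < n \<Longrightarrow> l t \<le> m (Suc t) - m t"
    and A: "A = digit_sums (p ^ k) p n (\<lambda>t. p ^ l t) m (\<lambda>t. m t + l t) \<alpha>"
    and C: "C = digit_sums (p ^ k) p n (\<lambda>t. p ^ (m (Suc t) - m t - l t))
      (\<lambda>t. m t + l t) (\<lambda>t. m (Suc t)) \<beta>"
  shows "bij_betw (\<lambda>(a, c). (a + c) mod int (p ^ k)) (A \<times> C) {0..<int (p ^ k)}"
proof -
  define N where "N = int (p ^ k)"
  define I where "I = index_tuples (\<lambda>t. p ^ l t) n"
  define J where "J = index_tuples (\<lambda>t. p ^ (m (Suc t) - m t - l t)) n"
  define F where "F = digit_value p n m (\<lambda>t. m t + l t) \<alpha>"
  define G where "G = digit_value p n (\<lambda>t. m t + l t) (\<lambda>t. m (Suc t)) \<beta>"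
  have m_le: "m s \<le> m t" if "s \<le> t" "t \<le> n" for s t
    using steps_mono[of n m] m(3) that by blast
  have ml: "m t + l t \<le> m (Suc t)" if "t < n" for t
    using m(3) l that by fastforce
  have separate: "i = i' \<and> j = j'"
    if ij: "i \<in> I" "i' \<in> I" "j \<in> J" "j' \<in> J" and cong: "[F i + G j = F i' + G j'] (mod N)"
    for i i' j j'
  proof -
    have "take t i = take t i' \<and> take t j = take t j'" if "t \<le> n" for t
      using that
    proof (induction t)
      case 0
      then show ?case by simp
    next
      case (Suc t)
      then have t: "t < n" and i: "take t i = take t i'" and j: "take t j = take t j'" by auto
      have sum: "[(F i - F i') + (G j - G j') = 0] (mod int p ^ M)" if "M \<le> k" for M
      proof -
        have "int p ^ M dvd N" using that by (simp add: N_def le_imp_power_dvd)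
        then have "[F i + G j = F i' + G j'] (mod int p ^ M)"
          using cong cong_dvd_modulus by blast
        then show ?thesis by (simp add: cong_iff_dvd_diff algebra_simps)
      qed
      have le: "m (Suc t) \<le> k" using m_le[of "Suc t" n] t m(2) by simp
      have later: "m (Suc t) \<le> m r" if "t < r" "r \<le> n" for r using m_le[of "Suc t" r] that by simp
      have len: "length i = n" "length i' = n" "length j = n" "length j' = n"
        using ij by (auto simp: I_def J_def index_tuples_def)
      have "[G j = G j'] (mod int p ^ (m t + l t))"
        unfolding G_def
      proof (rule digit_value_cong[OF j])
        fix r assume "t \<le> r" "r < n"
        then show "m t + l t \<le> m r + l r \<and> m t + l t \<le> m (Suc r)"
          using ml[OF t] later[of r] later[of "Suc r"] by (cases "r = t") auto
      qed
      then have "[G j - G j' = 0] (mod int p ^ (m t + l t))" by (simp add: cong_iff_dvd_diff)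
      moreover have "[F i - F i' = (int (i ! t) - int (i' ! t)) * int p ^ m t]
          (mod int p ^ (m t + l t))"
        unfolding F_def
      proof (rule digit_value_diff_cong[OF i t])
        fix r assume "t < r" "r < n"
        then show "m t + l t \<le> m r \<and> m t + l t \<le> m r + l r"
          using ml[OF t] later[of r] by auto
      qed
      ultimately have "[(int (i ! t) - int (i' ! t)) * int p ^ m t = 0] (mod int p ^ (m t + l t))"
        using sum[of "m t + l t"] ml[OF t] le
        by (metis (no_types, lifting) add.right_neutral cong_add cong_sym cong_trans le_trans)
      then have it: "i ! t = i' ! t"
        by (rule mult_power_cong_0_imp_eq)
          (use \<open>p > 0\<close> ij t in \<open>auto simp: I_def index_tuples_def\<close>)
      then have i': "take (Suc t) i = take (Suc t) i'"
        using i t len by (simp add: take_Suc_conv_app_nth)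
      have "[F i = F i'] (mod int p ^ m (Suc t))"
        unfolding F_def
        by (rule digit_value_cong[OF i']) (use later in \<open>auto intro: trans_le_add1\<close>)
      then have "[F i - F i' = 0] (mod int p ^ m (Suc t))" by (simp add: cong_iff_dvd_diff)
      moreover have "[G j - G j' = (int (j ! t) - int (j' ! t)) * int p ^ (m t + l t)]
          (mod int p ^ m (Suc t))"
        unfolding G_def
        by (rule digit_value_diff_cong[OF j t]) (use later in \<open>auto intro: trans_le_add1\<close>)
      ultimately have "[(int (j ! t) - int (j' ! t)) * int p ^ (m t + l t) = 0]
          (mod int p ^ m (Suc t))"
        using sum[of "m (Suc t)"] le
        by (metis (no_types, lifting) add.left_neutral cong_add cong_sym cong_trans)
      then have "j ! t = j' ! t"
        by (rule mult_power_cong_0_imp_eq)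
          (use \<open>p > 0\<close> ij t ml[OF t] in \<open>auto simp: J_def index_tuples_def\<close>)
      then show ?case
        using i' j t len by (simp add: take_Suc_conv_app_nth)
    qed
    from this[of n] show ?thesis
      using ij by (auto simp: I_def J_def index_tuples_def)
  qed
  have "N > 0" using \<open>p > 0\<close> by (simp add: N_def)
  have A': "A = (\<lambda>i. F i mod N) ` I" and C': "C = (\<lambda>j. G j mod N) ` J"
    by (simp_all add: A C digit_sums_eq F_def G_def I_def J_def N_def)
  have "inj_on (\<lambda>(i, j). (F i + G j) mod N) (I \<times> J)"
  proof (rule inj_onI)
    fix z z' assume "z \<in> I \<times> J" "z' \<in> I \<times> J"
      and "(\<lambda>(i, j). (F i + G j) mod N) z = (\<lambda>(i, j). (F i + G j) mod N) z'"
    then show "z = z'"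
      using separate[of "fst z" "fst z'" "snd z" "snd z'"]
      by (auto simp: cong_def case_prod_unfold prod_eq_iff)
  qed
  moreover have "card (I \<times> J) = p ^ k"
  proof -
    show ?thesis
      using prod_power_steps[of m n l p] m l
      by (simp add: I_def J_def card_cartesian_product finite_card_index_tuples)
  qed
  moreover have "(\<lambda>(i, j). (F i + G j) mod N) ` (I \<times> J) \<subseteq> {0..<N}"
    using \<open>N > 0\<close> by auto
  ultimately have image: "(\<lambda>(i, j). (F i + G j) mod N) ` (I \<times> J) = {0..<N}"
    by (intro card_subset_eq) (simp_all add: card_image N_def del: of_nat_power)
  show ?thesis
    unfolding bij_betw_def N_def[symmetric]
  proof
    show "inj_on (\<lambda>(a, c). (a + c) mod N) (A \<times> C)"
    proof (rule inj_onI)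
      fix z z' assume z: "z \<in> A \<times> C" "z' \<in> A \<times> C"
        and eq: "(\<lambda>(a, c). (a + c) mod N) z = (\<lambda>(a, c). (a + c) mod N) z'"
      obtain i j where ij: "i \<in> I" "j \<in> J" "z = (F i mod N, G j mod N)"
        using z(1) by (auto simp: A' C')
      obtain i' j' where ij': "i' \<in> I" "j' \<in> J" "z' = (F i' mod N, G j' mod N)"
        using z(2) by (auto simp: A' C')
      have "[F i + G j = F i' + G j'] (mod N)"
        using eq by (simp add: ij ij' cong_def mod_simps)
      then show "z = z'" using separate ij ij' by metis
    qed
    have "A \<times> C = (\<lambda>(i, j). (F i mod N, G j mod N)) ` (I \<times> J)"
      by (auto simp: A' C')
    then have "(\<lambda>(a, c). (a + c) mod N) ` (A \<times> C) = (\<lambda>(i, j). (F i + G j) mod N) ` (I \<times> J)"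
      by (simp add: image_image case_prod_unfold mod_simps)
    then show "(\<lambda>(a, c). (a + c) mod N) ` (A \<times> C) = {0..<N}" by (simp add: image)
  qed
qed

section \<open>Sets determined by their free digits\<close>

text \<open>
  The base-\<open>p\<close> digits of \<open>a\<close> at the positions from \<open>x\<close> to \<open>y - 1\<close>, read as one number.
\<close>

definition block :: "nat \<Rightarrow> nat \<Rightarrow> nat \<Rightarrow> int \<Rightarrow> nat" where
  "block p x y a = nat ((a div int p ^ x) mod int p ^ (y - x))"

definition blocks :: "nat \<Rightarrow> nat \<Rightarrow> (nat \<Rightarrow> nat) \<Rightarrow> (nat \<Rightarrow> nat) \<Rightarrow> int \<Rightarrow> nat list" where
  "blocks p n d e a = map (\<lambda>t. block p (d t) (e t) a) [0..<n]"

lemma mod_power_split: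
  fixes a :: int
  assumes "p > 0" "x \<le> y"
  shows "a mod int p ^ y = int (block p x y a) * int p ^ x + a mod int p ^ x"
proof -
  have "a mod int p ^ y = a mod (int p ^ x * int p ^ (y - x))"
    using \<open>x \<le> y\<close> by (simp flip: power_add)
  also have "\<dots> = int p ^ x * (a div int p ^ x mod int p ^ (y - x)) + a mod int p ^ x"
    using \<open>p > 0\<close> by (simp add: zmod_zmult2_eq)
  finally show ?thesis
    using \<open>p > 0\<close> by (simp add: block_def mult.commute)
qed

lemma block_less: "p > 0 \<Longrightarrow> block p x y a < p ^ (y - x)"
  by (simp add: block_def nat_less_iff)

lemma block_cong:
  assumes "p > 0" "x \<le> y" "int p ^ y dvd a - a'"
  shows "block p x y a = block p x y a'"
proof -
  have y: "a mod int p ^ y = a' mod int p ^ y"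
    using assms(3) by (simp add: mod_eq_dvd_iff)
  have "int p ^ x dvd a - a'"
    using assms(2,3) by (meson dvd_trans le_imp_power_dvd)
  then have "a mod int p ^ x = a' mod int p ^ x" by (simp add: mod_eq_dvd_iff)
  then have "int (block p x y a) * int p ^ x = int (block p x y a') * int p ^ x"
    using y mod_power_split[OF assms(1,2), of a] mod_power_split[OF assms(1,2), of a'] by linarith
  then show ?thesis using \<open>p > 0\<close> by simp
qed

lemma block_0 [simp]: "block p x y 0 = 0"
  by (simp add: block_def)

text \<open>
  Positions from \<open>d t\<close> to \<open>e t - 1\<close> form the free blocks, those from \<open>e t\<close> to \<open>d (Suc t) - 1\<close> and
  those below \<open>d 0\<close> the gaps. The last hypothesis says that the lowest digit in which two distinct
  elements of \<open>A\<close> differ lies in a free block; thus the digits in the gaps are functions of the free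
  digits below them. Both factors of a tiling modulo a prime power are of this kind, with
  complementary free blocks.
\<close>

locale separated_set =
  fixes p k n :: nat and d e :: "nat \<Rightarrow> nat" and A :: "int set"
  assumes p_pos: "p > 0"
    and d_le_e: "\<And>t. t < n \<Longrightarrow> d t \<le> e t"
    and e_le_d: "\<And>t. t < n \<Longrightarrow> e t \<le> d (Suc t)"
    and d_n: "d n = k"
    and in_range: "A \<subseteq> {0..<int (p ^ k)}"
    and separated: "\<And>a a'. a \<in> A \<Longrightarrow> a' \<in> A \<Longrightarrow> a \<noteq> a' \<Longrightarrow>
      \<exists>t<n. \<exists>j. d t \<le> j \<and> j < e t \<and> int p ^ j dvd a - a' \<and> \<not> int p ^ Suc j dvd a - a'"
begin

abbreviation index :: "int \<Rightarrow> nat list" where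
  "index \<equiv> blocks p n d e"

abbreviation indices :: "nat \<Rightarrow> nat list set" where
  "indices \<equiv> index_tuples (\<lambda>t. p ^ (e t - d t))"

lemma d_mono: "s \<le> t \<Longrightarrow> t \<le> n \<Longrightarrow> d s \<le> d t"
  using steps_mono[of n d s t] le_trans[OF d_le_e e_le_d] by blast

lemma length_index [simp]: "length (index a) = n"
  by (simp add: blocks_def)

lemma nth_index: "t < n \<Longrightarrow> index a ! t = block p (d t) (e t) a"
  by (simp add: blocks_def)

lemma index_in_indices: "index a \<in> indices n"
  by (simp add: index_tuples_def nth_index block_less p_pos)

lemma index_prefix_determines_residue:
  assumes a: "a \<in> A" and a': "a' \<in> A" and "t \<le> n" and "take t (index a) = take t (index a')"
  shows "int p ^ d t dvd a - a'"
proof (cases "a = a'")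
  case False
  then obtain s j where s: "s < n" "d s \<le> j" "j < e s"
    and j: "int p ^ j dvd a - a'" "\<not> int p ^ Suc j dvd a - a'"
    using separated[OF a a'] by blast
  show ?thesis
  proof (cases "s < t")
    case True
    have "index a ! s = index a' ! s"
      using nth_take_eqI[OF assms(4) True] .
    then have "block p (d s) (e s) a = block p (d s) (e s) a'"
      using s(1) by (simp add: nth_index)
    moreover have "a mod int p ^ d s = a' mod int p ^ d s"
      using j(1) s(2) by (meson dvd_trans le_imp_power_dvd mod_eq_dvd_iff)
    ultimately have "a mod int p ^ e s = a' mod int p ^ e s"
      using mod_power_split[OF p_pos d_le_e[OF s(1)]] by metis
    then have "int p ^ e s dvd a - a'" by (simp add: mod_eq_dvd_iff)
    moreover have "int p ^ Suc j dvd int p ^ e s"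
      using s(3) by (intro le_imp_power_dvd) simp
    ultimately show ?thesis using j(2) dvd_trans by blast
  next
    case False
    then have "d t \<le> j" using d_mono[of t s] s by simp
    then show ?thesis using j(1) by (meson dvd_trans le_imp_power_dvd)
  qed
qed simp

lemma mod_eq_self: "a \<in> A \<Longrightarrow> a mod int p ^ k = a"
  using in_range by (intro mod_pos_pos_trivial) auto

lemma inj_index: "inj_on index A"
proof (rule inj_onI)
  fix a a' assume a: "a \<in> A" "a' \<in> A" and "index a = index a'"
  then have "int p ^ k dvd a - a'"
    using index_prefix_determines_residue[OF a, of n] d_n by simp
  then have "a mod int p ^ k = a' mod int p ^ k" by (simp add: mod_eq_dvd_iff)
  then show "a = a'" using a by (simp add: mod_eq_self)
qed

lemma card_le: "card A \<le> (\<Prod>t<n. p ^ (e t - d t))"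
proof -
  have "card A = card (index ` A)" by (simp add: card_image inj_index)
  also have "\<dots> \<le> card (indices n)"
    by (rule card_mono) (use finite_card_index_tuples index_in_indices in auto)
  finally show ?thesis by (simp add: finite_card_index_tuples)
qed

text \<open>
  By \<open>inj_index\<close> an element is determined by its free digits; maximal cardinality means that all
  choices of free digits occur. The coefficient \<open>\<gamma>\<close> of a prefix consists of the digits in the gap
  after it, which can be taken from any element having this prefix. Then the digit sum is just
  the base-\<open>p\<close> expansion. The normalisation of \<open>\<gamma>\<close> at zero prefixes comes from the element 0.
\<close>

theorem eq_digit_sums:
  assumes "0 \<in> A" and card: "card A = (\<Prod>t<n. p ^ (e t - d t))"
  shows "\<exists>\<gamma>. coeff_family {0..<int (p ^ k)} (\<lambda>t. p ^ (e t - d t)) n \<gamma> \<and>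
    A = digit_sums (p ^ k) p n (\<lambda>t. p ^ (e t - d t)) d e \<gamma>"
proof -
  have surj: "index ` A = indices n"
    by (rule card_subset_eq)
      (use index_in_indices card in \<open>auto simp: finite_card_index_tuples card_image inj_index\<close>)
  define rep where "rep i = (SOME a. a \<in> A \<and> take (length i) (index a) = i)" for i
  define \<gamma> where "\<gamma> i = int (block p (e (length i - 1)) (d (length i)) (rep i))" for i
  have rep: "\<gamma> (take (Suc t) (index a)) = int (block p (e t) (d (Suc t)) a)"
    if "a \<in> A" "t < n" for a t
  proof -
    define i where "i = take (Suc t) (index a)"
    have len: "length i = Suc t" using that by (simp add: i_def)
    have "rep i \<in> A \<and> take (length i) (index (rep i)) = i"
      unfolding rep_def by (rule someI[of _ a]) (use that len in \<open>simp add: i_def\<close>)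
    then have "int p ^ d (Suc t) dvd rep i - a"
      using that len by (intro index_prefix_determines_residue) (auto simp: i_def)
    then show ?thesis
      unfolding i_def[symmetric] \<gamma>_def len
      by (simp add: block_cong[OF p_pos e_le_d[OF that(2)]])
  qed
  have "coeff_family {0..<int (p ^ k)} (\<lambda>t. p ^ (e t - d t)) n \<gamma>"
    unfolding coeff_family_def
  proof (intro allI impI conjI ballI)
    fix t i assume t: "t < n" and "i \<in> indices (Suc t)"
    then have "length i = Suc t" by (simp add: index_tuples_def)
    moreover have "block p (e t) (d (Suc t)) (rep i) < p ^ (d (Suc t) - e t)"
      by (rule block_less[OF p_pos])
    moreover have "p ^ (d (Suc t) - e t) \<le> p ^ k"
      using d_mono[of "Suc t" n] d_n t p_pos by (intro power_increasing) auto
    ultimately show "\<gamma> i \<in> {0..<int (p ^ k)}"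
      by (simp add: \<gamma>_def del: of_nat_power)
  next
    fix t assume t: "t < n"
    have "take (Suc t) (index 0) = replicate (Suc t) 0"
      using t by (intro nth_equalityI) (auto simp: nth_index simp del: replicate_Suc)
    then show "\<gamma> (replicate (Suc t) 0) = 0"
      using rep[OF \<open>0 \<in> A\<close> t] by simp
  qed
  moreover have "A = digit_sums (p ^ k) p n (\<lambda>t. p ^ (e t - d t)) d e \<gamma>"
  proof -
    have "digit_value p n d e \<gamma> (index a) = a" if a: "a \<in> A" for a
    proof -
      have "(\<Sum>s<t. int (index a ! s) * int p ^ d s + \<gamma> (take (Suc s) (index a)) * int p ^ e s)
          = a mod int p ^ d t" if "t \<le> n" for t
        using that
      proof (induction t)
        case 0
        have "int p ^ d 0 dvd a"
          using index_prefix_determines_residue[OF a \<open>0 \<in> A\<close>, of 0] by simp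
        then show ?case by simp
      next
        case (Suc t)
        then have t: "t < n" by simp
        show ?case
          using Suc mod_power_split[OF p_pos e_le_d[OF t], of a]
            mod_power_split[OF p_pos d_le_e[OF t], of a]
          by (simp add: rep[OF a t] nth_index t)
      qed
      from this[of n] have "digit_value p n d e \<gamma> (index a) = a mod int p ^ k"
        by (simp add: digit_value_def d_n)
      then show ?thesis using a by (simp add: mod_eq_self)
    qed
    then have "(\<lambda>i. digit_value p n d e \<gamma> i mod int (p ^ k)) ` index ` A = (\<lambda>a. a) ` A"
      unfolding image_image by (intro image_cong) (simp_all add: mod_eq_self)
    then show ?thesis by (simp add: digit_sums_eq surj)
  qed
  ultimately show ?thesis by blast
qed

end

section \<open>Perfect codes as tilings\<close>

text \<open>
  The closed out-neighbourhood of \<open>c\<close> is the translate of \<open>S \<union> {\<one>}\<close> by \<open>c\<close>. Translation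
  is injective, so the only collisions left to exclude are those between different translates.
\<close>

lemma (in group) perfect_code_Cay_iff:
  assumes "S \<subseteq> carrier G" and "C \<subseteq> carrier G"
  shows "perfect_code (with_proj (Cay G S)) C \<longleftrightarrow>
    bij_betw (\<lambda>(s, c). s \<otimes> c) ((S \<union> {\<one>}) \<times> C) (carrier G)"
proof -
  let ?D = "with_proj (Cay G S)"
  have nbhd: "closed_out_nbhd ?D c = (\<lambda>s. s \<otimes> c) ` (S \<union> {\<one>})" if c: "c \<in> C" for c
  proof -
    have cG: "c \<in> carrier G" using c assms by auto
    have "v \<in> carrier G \<and> v \<otimes> inv c \<in> S \<longleftrightarrow> v \<in> (\<lambda>s. s \<otimes> c) ` S" for v
    proof
      assume v: "v \<in> carrier G \<and> v \<otimes> inv c \<in> S"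
      then have "v = (v \<otimes> inv c) \<otimes> c" using cG by (simp add: m_assoc)
      then show "v \<in> (\<lambda>s. s \<otimes> c) ` S" using v by blast
    next
      assume "v \<in> (\<lambda>s. s \<otimes> c) ` S"
      then obtain s where s: "s \<in> S" "v = s \<otimes> c" by blast
      then have "s \<in> carrier G" using assms by auto
      then show "v \<in> carrier G \<and> v \<otimes> inv c \<in> S" using s cG by (simp add: m_assoc)
    qed
    then show ?thesis
      using cG by (auto simp: closed_out_nbhd_def Cay_def)
  qed
  have cancel: "s = s'" if "s \<in> S \<union> {\<one>}" "s' \<in> S \<union> {\<one>}" "c \<in> C" "s \<otimes> c = s' \<otimes> c" for s s' c
  proof -
    have "s \<in> carrier G" "s' \<in> carrier G" "c \<in> carrier G" using that assms by auto
    then show ?thesis using that(4) by (simp add: right_cancel)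
  qed
  have image: "(\<Union>c\<in>C. (\<lambda>s. s \<otimes> c) ` X) = (\<lambda>(s, c). s \<otimes> c) ` (X \<times> C)" for X
    by force
  have union: "(\<Union>c\<in>C. closed_out_nbhd ?D c) = (\<lambda>(s, c). s \<otimes> c) ` ((S \<union> {\<one>}) \<times> C)"
    unfolding image[symmetric] by (rule SUP_cong[OF refl nbhd])
  have inj: "disjoint_family_on (closed_out_nbhd ?D) C \<longleftrightarrow>
      inj_on (\<lambda>(s, c). s \<otimes> c) ((S \<union> {\<one>}) \<times> C)"
  proof
    assume disj: "disjoint_family_on (closed_out_nbhd ?D) C"
    show "inj_on (\<lambda>(s, c). s \<otimes> c) ((S \<union> {\<one>}) \<times> C)"
    proof (rule inj_onI, unfold split_paired_all split_conv mem_Times_iff fst_conv snd_conv, elim conjE)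
      fix s s' c c'
      assume s: "s \<in> S \<union> {\<one>}" "s' \<in> S \<union> {\<one>}" and c: "c \<in> C" "c' \<in> C"
        and eq: "s \<otimes> c = s' \<otimes> c'"
      have "s \<otimes> c \<in> closed_out_nbhd ?D c"
        unfolding nbhd[OF c(1)] using s(1) by (rule imageI)
      moreover have "s \<otimes> c \<in> closed_out_nbhd ?D c'"
        unfolding nbhd[OF c(2)] eq using s(2) by (rule imageI)
      ultimately have "c = c'" using disj c unfolding disjoint_family_on_def by blast
      then show "(s, c) = (s', c')" using cancel[OF s c(1)] eq by simp
    qed
  next
    assume inj: "inj_on (\<lambda>(s, c). s \<otimes> c) ((S \<union> {\<one>}) \<times> C)"
    show "disjoint_family_on (closed_out_nbhd ?D) C"
      unfolding disjoint_family_on_def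
    proof (intro ballI impI)
      fix c c' assume c: "c \<in> C" "c' \<in> C" "c \<noteq> c'"
      have False if v: "v \<in> closed_out_nbhd ?D c" "v \<in> closed_out_nbhd ?D c'" for v
      proof -
        obtain s where s: "v = s \<otimes> c" "s \<in> S \<union> {\<one>}"
          using v(1) unfolding nbhd[OF c(1)] by (rule imageE)
        obtain s' where s': "v = s' \<otimes> c'" "s' \<in> S \<union> {\<one>}"
          using v(2) unfolding nbhd[OF c(2)] by (rule imageE)
        have "(s, c) = (s', c')"
          by (rule inj_onD[OF inj _ SigmaI[OF s(2) c(1)] SigmaI[OF s'(2) c(2)]])
            (simp flip: s(1) s'(1))
        then show False using c(3) by simp
      qed
      then show "closed_out_nbhd ?D c \<inter> closed_out_nbhd ?D c' = {}" by blast
    qed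
  qed
  have "verts ?D = carrier G" by (simp add: Cay_def)
  then show ?thesis
    using assms(2) union inj by (simp add: perfect_code_def bij_betw_def)
qed

text \<open>
  Otherwise all of \<open>S\<close> would lie in the proper subgroup of multiples of \<open>q\<close>.
\<close>

lemma generating_set_has_unit:
  assumes "N > 1" and "q dvd int N" and "\<not> q dvd 1"
    and "generate (integer_mod_group N) S = carrier (integer_mod_group N)"
    and "S \<subseteq> carrier (integer_mod_group N)"
  shows "\<exists>s\<in>S. \<not> q dvd s"
proof (rule ccontr)
  assume "\<not> (\<exists>s\<in>S. \<not> q dvd s)"
  then have S: "q dvd s" if "s \<in> S" for s using that by blast
  have "q dvd x" if "x \<in> generate (integer_mod_group N) S" for x
    using that
  proof (induction rule: generate.induct)
    case (inv h)
    then have "m_inv (integer_mod_group N) h = (- h) mod int N"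
      using assms(5) by (intro inv_integer_mod_group) auto
    then show ?case using S[OF inv] assms(2) by (simp add: dvd_mod_iff)
  qed (use S assms(2) in \<open>auto simp: dvd_mod_iff\<close>)
  moreover have "1 \<in> generate (integer_mod_group N) S"
    using assms(1) by (simp add: assms(4))
  ultimately show False using assms(3) by blast
qed

section \<open>Tilings of the integers modulo a prime power\<close>

lemma ex_exact_power_dvd:
  fixes z :: int
  assumes "z \<noteq> 0" and "\<bar>z\<bar> < int p ^ k"
  shows "\<exists>j<k. int p ^ j dvd z \<and> \<not> int p ^ Suc j dvd z"
proof -
  have not_dvd: "\<not> int p ^ k dvd z"
    using assms(1,2) zdvd_imp_le[of "int p ^ k" "\<bar>z\<bar>"] by auto
  define j where "j = (LEAST j. \<not> int p ^ j dvd z)"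
  have j: "\<not> int p ^ j dvd z" "j \<le> k"
    using LeastI[of "\<lambda>j. \<not> int p ^ j dvd z", OF not_dvd]
      Least_le[of "\<lambda>j. \<not> int p ^ j dvd z", OF not_dvd] by (simp_all add: j_def)
  have "j \<noteq> 0" using j(1) by (cases j) simp_all
  then obtain i where i: "j = Suc i" by (cases j) auto
  have "int p ^ i dvd z"
    using i not_less_Least[of i "\<lambda>j. \<not> int p ^ j dvd z"] by (simp add: j_def)
  moreover have "\<not> int p ^ Suc i dvd z" using j(1) unfolding i .
  moreover have "i < k" using j(2) i by simp
  ultimately show ?thesis by (intro exI[of _ i] conjI)
qed

lemma ex_step_containing:
  fixes m :: "nat \<Rightarrow> nat"
  assumes "m 0 \<le> j" and "j < m n"
  shows "\<exists>t<n. m t \<le> j \<and> j < m (Suc t)"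
proof (rule ccontr)
  assume "\<not> ?thesis"
  then have step: "m t \<le> j \<Longrightarrow> m (Suc t) \<le> j" if "t < n" for t
    using that by (meson not_le)
  have "t \<le> n \<Longrightarrow> m t \<le> j" for t
    by (induction t) (use step assms(1) in auto)
  then show False using assms(2) by (metis le_refl not_le)
qed

lemma factors_eq_if_le_and_prod_eq:
  fixes x y a c :: nat
  assumes "a * c = x * y" and "x \<le> a" "y \<le> c" and "a > 0" "c > 0"
  shows "x = a" and "y = c"
proof -
  have "\<not> x < a"
  proof
    assume "x < a"
    then have "x * c < a * c" using \<open>c > 0\<close> by simp
    moreover have "x * y \<le> x * c" using \<open>y \<le> c\<close> by simp
    ultimately show False using assms(1) by simp
  qed
  then show "x = a" using assms(2) by simp
  then show "y = c" using assms(1,4) by simp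
qed

text \<open>
  Let \<open>D\<close> be the set of valuations of differences of elements of \<open>A\<close>. The free blocks are cut out
  as single digits: \<open>m\<close> enumerates \<open>D\<close> and every \<open>l t\<close> with \<open>t < n\<close> is 1, so that neighbouring elements of \<open>D\<close>
  simply leave an empty block for \<open>C\<close>. The valuations of differences of elements of \<open>C\<close> avoid
  \<open>D\<close>, so \<open>A\<close> and \<open>C\<close> are separated sets with complementary free blocks. The resulting upper bounds
  for their cardinalities have the product \<open>p ^ k = card A * card C\<close>, hence both are attained.
  The element of \<open>A\<close> prime to \<open>p\<close> puts 0 into \<open>D\<close>, which gives \<open>m 0 = 0\<close>.
\<close>

theorem tiling_imp_digit_sums:
  fixes p k :: nat and A C :: "int set"
  assumes "prime p" and A: "A \<subseteq> {0..<int (p ^ k)}" and C: "C \<subseteq> {0..<int (p ^ k)}"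
    and "0 \<in> A" "0 \<in> C" and unit: "\<exists>a\<in>A. \<not> int p dvd a"
    and tiling: "bij_betw (\<lambda>(a, c). (a + c) mod int (p ^ k)) (A \<times> C) {0..<int (p ^ k)}"
  shows "\<exists>(n::nat) (m :: nat \<Rightarrow> nat) (l :: nat \<Rightarrow> nat).
       n \<ge> 1 \<and> m 0 = 0 \<and> m n = k \<and> (\<forall>t<n. m t < m (Suc t)) \<and>
       (\<forall>t<n. 1 \<le> l t \<and> l t \<le> m (Suc t) - m t) \<and>
       (\<exists>\<alpha> \<beta> :: nat list \<Rightarrow> int.
          coeff_family {0..<int (p ^ k)} (\<lambda>t. p ^ l t) n \<alpha> \<and>
          coeff_family {0..<int (p ^ k)} (\<lambda>t. p ^ (m (Suc t) - m t - l t)) n \<beta> \<and>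
          A = digit_sums (p ^ k) p n (\<lambda>t. p ^ l t) m (\<lambda>t. m t + l t) \<alpha> \<and>
          C = digit_sums (p ^ k) p n (\<lambda>t. p ^ (m (Suc t) - m t - l t))
                (\<lambda>t. m t + l t) (\<lambda>t. m (Suc t)) \<beta>)"
proof -
  have "p > 0" using \<open>prime p\<close> by (rule prime_gt_0_nat)
  define D where "D = {j. j < k \<and>
    (\<exists>a\<in>A. \<exists>a'\<in>A. int p ^ j dvd a - a' \<and> \<not> int p ^ Suc j dvd a - a')}"
  have "finite D" by (simp add: D_def)
  have exact: "\<exists>j<k. int p ^ j dvd x - y \<and> \<not> int p ^ Suc j dvd x - y"
    if "x \<in> X" "y \<in> X" "x \<noteq> y" "X \<subseteq> {0..<int (p ^ k)}" for x y X
  proof (rule ex_exact_power_dvd)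
    have "x \<in> {0..<int p ^ k}" "y \<in> {0..<int p ^ k}" using that by auto
    then show "\<bar>x - y\<bar> < int p ^ k" by auto
  qed (use that in simp)
  have "0 \<in> D"
  proof -
    obtain a where a: "a \<in> A" "\<not> int p dvd a" using unit by blast
    then have "a \<noteq> 0" by auto
    then have "k > 0" using exact[OF a(1) \<open>0 \<in> A\<close> _ A] by auto
    then show ?thesis
      using a \<open>0 \<in> A\<close> unfolding D_def
      by (intro CollectI conjI bexI[of _ a] bexI[of _ 0]) simp_all
  qed
  obtain h where h: "bij_betw h {..<card D} D" "strict_mono_on {..<card D} h"
    using ex_bij_betw_strict_mono_card[OF \<open>finite D\<close>] .
  define n where "n = card D"
  \<comment> \<open>The values \<open>m n = k\<close> and \<open>l n = 0\<close> make the last block for \<open>C\<close> end, like the group, at \<open>k\<close>.\<close>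
  define m where "m t = (if t < n then h t else k)" for t
  define l :: "nat \<Rightarrow> nat" where "l t = (if t < n then 1 else 0)" for t
  have m_in_D: "m t \<in> D" if "t < n" for t
    using that h(1) by (auto simp: m_def n_def bij_betw_def)
  have ex_m: "\<exists>t<n. m t = j" if "j \<in> D" for j
  proof -
    have "j \<in> h ` {..<n}" using that h(1) by (simp add: n_def bij_betw_def)
    then obtain t where "t < n" "h t = j" by auto
    then show ?thesis by (intro exI[of _ t]) (simp add: m_def)
  qed
  have "n \<ge> 1"
    using \<open>0 \<in> D\<close> \<open>finite D\<close> by (auto simp: n_def Suc_le_eq card_gt_0_iff)
  have m_n: "m n = k" by (simp add: m_def)
  have m_less: "m t < m (Suc t)" if "t < n" for t
  proof (cases "Suc t < n")
    case True
    then show ?thesis using h(2) by (simp add: m_def n_def strict_mono_on_def)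
  next
    case False
    then show ?thesis using m_in_D[OF that] by (simp add: m_def[of "Suc t"] D_def)
  qed
  have m_0: "m 0 = 0"
  proof -
    obtain t where t: "t < n" "m t = 0" using ex_m[OF \<open>0 \<in> D\<close>] by blast
    then show ?thesis using steps_mono[of n m 0 t] m_less by (simp add: less_imp_le)
  qed
  interpret A: separated_set p k n m "\<lambda>t. m t + l t" A
  proof
    fix a a' assume a: "a \<in> A" "a' \<in> A" "a \<noteq> a'"
    then obtain j where j: "j < k" "int p ^ j dvd a - a'" "\<not> int p ^ Suc j dvd a - a'"
      using exact[OF _ _ _ A] by blast
    then have "j \<in> D" using a by (auto simp: D_def)
    then obtain t where "t < n" "m t = j" using ex_m by blast
    then show "\<exists>t<n. \<exists>j. m t \<le> j \<and> j < m t + l t \<and> int p ^ j dvd a - a' \<and>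
        \<not> int p ^ Suc j dvd a - a'"
      using j by (intro exI[of _ t] conjI exI[of _ j]) (simp_all add: l_def)
  qed (use \<open>p > 0\<close> A m_n in \<open>auto simp: l_def Suc_le_eq m_less\<close>)
  interpret C: separated_set p k n "\<lambda>t. m t + l t" "\<lambda>t. m (Suc t)" C
  proof
    fix c c' assume c: "c \<in> C" "c' \<in> C" "c \<noteq> c'"
    then obtain j where j: "j < k" "int p ^ j dvd c - c'" "\<not> int p ^ Suc j dvd c - c'"
      using exact[OF _ _ _ C] by blast
    then have "j \<notin> D"
      using tiling_no_common_valuation[OF \<open>prime p\<close> tiling A C _ _ c(1,2) j(1) _ _ j(2,3)]
      by (auto simp: D_def)
    obtain t where t: "t < n" "m t \<le> j" "j < m (Suc t)"
      using ex_step_containing[of m j n] m_0 m_n j(1) by auto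
    moreover have "m t \<noteq> j" using \<open>j \<notin> D\<close> m_in_D[OF t(1)] by auto
    ultimately show "\<exists>t<n. \<exists>j. m t + l t \<le> j \<and> j < m (Suc t) \<and> int p ^ j dvd c - c' \<and>
        \<not> int p ^ Suc j dvd c - c'"
      using j by (intro exI[of _ t] conjI exI[of _ j]) (simp_all add: l_def)
  qed (use \<open>p > 0\<close> C m_n m_less in \<open>auto simp: l_def Suc_le_eq\<close>)
  define a c where "a = (\<Prod>t<n. p ^ l t)" and "c = (\<Prod>t<n. p ^ (m (Suc t) - m t - l t))"
  have l_le: "l t \<le> m (Suc t) - m t" if "t < n" for t
    using m_less[OF that] that by (simp add: l_def)
  have "a * c = p ^ k"
    using prod_power_steps[of m n l p] m_0 m_n m_less l_le by (simp add: a_def c_def less_imp_le)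
  moreover have "card A * card C = p ^ k"
    using bij_betw_same_card[OF tiling] by (simp add: card_cartesian_product del: of_nat_power)
  moreover have "card A \<le> a" "card C \<le> c"
    using A.card_le C.card_le by (simp_all add: a_def c_def)
  moreover have "a > 0" "c > 0" using \<open>p > 0\<close> by (simp_all add: a_def c_def)
  ultimately have card: "card A = a" "card C = c"
    using factors_eq_if_le_and_prod_eq[of a c "card A" "card C"] by simp_all
  obtain \<alpha> where \<alpha>: "coeff_family {0..<int (p ^ k)} (\<lambda>t. p ^ l t) n \<alpha>"
    "A = digit_sums (p ^ k) p n (\<lambda>t. p ^ l t) m (\<lambda>t. m t + l t) \<alpha>"
    using A.eq_digit_sums[OF \<open>0 \<in> A\<close>] card by (auto simp: a_def)
  obtain \<beta> where \<beta>: "coeff_family {0..<int (p ^ k)} (\<lambda>t. p ^ (m (Suc t) - m t - l t)) n \<beta>"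
    "C = digit_sums (p ^ k) p n (\<lambda>t. p ^ (m (Suc t) - m t - l t)) (\<lambda>t. m t + l t)
      (\<lambda>t. m (Suc t)) \<beta>"
    using C.eq_digit_sums[OF \<open>0 \<in> C\<close>] card by (auto simp: c_def)
  have "\<forall>t<n. 1 \<le> l t \<and> l t \<le> m (Suc t) - m t"
    using l_le by (simp add: l_def)
  then show ?thesis
    using \<open>n \<ge> 1\<close> m_0 m_n m_less \<alpha> \<beta> by blast
qed

theorem theorem4p1:
  fixes p k :: nat and S C :: "int set"
  assumes "prime p" and "k \<ge> 1"
    and "S \<subset> carrier (integer_mod_group (p ^ k)) - {\<one>\<^bsub>integer_mod_group (p ^ k)\<^esub>}"
    and "generate (integer_mod_group (p ^ k)) S = carrier (integer_mod_group (p ^ k))"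
    and "\<one>\<^bsub>integer_mod_group (p ^ k)\<^esub> \<in> C"
    and "C \<subseteq> carrier (integer_mod_group (p ^ k))"
  shows "perfect_code (with_proj (Cay (integer_mod_group (p ^ k)) S)) C \<longleftrightarrow>
    (\<exists>(n::nat) (m :: nat \<Rightarrow> nat) (l :: nat \<Rightarrow> nat).
       n \<ge> 1 \<and> m 0 = 0 \<and> m n = k \<and> (\<forall>t<n. m t < m (Suc t)) \<and>
       (\<forall>t<n. 1 \<le> l t \<and> l t \<le> m (Suc t) - m t) \<and>
       (\<exists>\<alpha> \<beta> :: nat list \<Rightarrow> int.
          coeff_family (carrier (integer_mod_group (p ^ k))) (\<lambda>t. p ^ l t) n \<alpha> \<and>
          coeff_family (carrier (integer_mod_group (p ^ k)))
            (\<lambda>t. p ^ (m (Suc t) - m t - l t)) n \<beta> \<and>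
          S \<union> {\<one>\<^bsub>integer_mod_group (p ^ k)\<^esub>} =
            digit_sums (p ^ k) p n (\<lambda>t. p ^ l t) m (\<lambda>t. m t + l t) \<alpha> \<and>
          C = digit_sums (p ^ k) p n (\<lambda>t. p ^ (m (Suc t) - m t - l t))
                (\<lambda>t. m t + l t) (\<lambda>t. m (Suc t)) \<beta>))"
proof -
  let ?Z = "integer_mod_group (p ^ k)"
  have "p > 0" using \<open>prime p\<close> by (rule prime_gt_0_nat)
  have carrier: "carrier ?Z = {0..<int (p ^ k)}"
    using \<open>p > 0\<close> by (simp add: carrier_integer_mod_group)
  have S: "S \<subseteq> carrier ?Z" using assms(3) by auto
  have code: "perfect_code (with_proj (Cay ?Z S)) C \<longleftrightarrow>
      bij_betw (\<lambda>(s, c). (s + c) mod int (p ^ k)) ((S \<union> {0}) \<times> C) {0..<int (p ^ k)}"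
    using group.perfect_code_Cay_iff[OF group_integer_mod_group S assms(6)]
    unfolding carrier mult_integer_mod_group one_integer_mod_group .
  have "\<exists>s\<in>S. \<not> int p dvd s"
  proof (rule generating_set_has_unit[OF _ _ _ assms(4) S])
    show "p ^ k > 1" using \<open>k \<ge> 1\<close> by (intro one_less_power prime_gt_1_nat[OF \<open>prime p\<close>]) simp
    show "int p dvd int (p ^ k)" using \<open>k \<ge> 1\<close> by (simp add: dvd_power)
    show "\<not> int p dvd 1" using prime_gt_1_nat[OF \<open>prime p\<close>] by simp
  qed
  then have unit: "\<exists>s\<in>S \<union> {0}. \<not> int p dvd s" by blast
  have S0: "S \<union> {0} \<subseteq> {0..<int (p ^ k)}" using S \<open>p > 0\<close> by (simp add: carrier)
  have C: "C \<subseteq> {0..<int (p ^ k)}" "0 \<in> C" using assms(5,6) unfolding carrier by simp_all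
  show ?thesis (is "?L \<longleftrightarrow> ?R")
  proof
    assume ?L
    then show ?R
      unfolding code carrier one_integer_mod_group
      by (intro tiling_imp_digit_sums[OF \<open>prime p\<close> S0 C(1) _ C(2) unit]) simp
  next
    assume ?R
    then obtain n m l \<alpha> \<beta> where "m 0 = 0" "m n = k" "\<forall>t<n. m t < m (Suc t)"
      "\<forall>t<n. 1 \<le> l t \<and> l t \<le> m (Suc t) - m t"
      "S \<union> {0} = digit_sums (p ^ k) p n (\<lambda>t. p ^ l t) m (\<lambda>t. m t + l t) \<alpha>"
      "C = digit_sums (p ^ k) p n (\<lambda>t. p ^ (m (Suc t) - m t - l t))
        (\<lambda>t. m t + l t) (\<lambda>t. m (Suc t)) \<beta>"
      unfolding one_integer_mod_group by blast
    then show ?L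
      unfolding code using \<open>p > 0\<close>
      by (intro digit_sums_tile[where m = m and l = l and n = n]) (auto simp: less_imp_le)
  qed
qed

end
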